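(* Let $G=(V,E,P)$ be an LWF chain graph model, i.e. $V$ is a finite set of random variables, $(V,E)$ is an LWF chain graph, and $P$ is a joint probability distribution over $V$ satisfying the global Markov property for LWF chain graphs with respect to $(V,E)$. For $T\in V$ let $\mathbf{Mb}(T)=bd(T)\cup ch(T)\cup csp(T)$ be the union of the sets of parents, neighbors, children and complex-spouses of $T$. Then for every $T\in V$, under $P$, the variable $T$ is independent of $V\setminus(\{T\}\cup\mathbf{Mb}(T))$ given $\mathbf{Mb}(T)$: $$T \perp\!\!\!\perp_P \; V\setminus(\{T\}\cup \mathbf{Mb}(T))\;\mid\;\mathbf{Mb}(T).$$
   Context: Graphs are finite and simple (at most one edge between two distinct vertices, no loops), and each edge is either directed ($u\to v$) or undirected ($u-v$). A partially directed cycle is a sequence $v_1,\dots,v_n$, $n\ge 3$, $v_n=v_1$, otherwise distinct vertices, such that for each $i<n$ either $v_i-v_{i+1}$ or $v_i\to v_{i+1}$, with at least one edge $v_j\to v_{j+1}$. An LWF chain graph (CG) is such a graph with no partially directed cycle. $pa(v)=\{u: u\to v\}$, $ch(v)=\{u: v\to u\}$, $ne(v)=\{u: u-v\}$. For $A\subseteq V$, the boundary $bd(A)$ is the set of vertices in $V\setminus A$ that are parents or neighbors of some vertex of $A$; $bd(v)=bd(\{v\})=pa(v)\cup ne(v)$. A set $A$ is ancestral if $bd(a)\subseteq A$ for all $a\in A$; $An(A)$ is the smallest ancestral set containing $A$. A minimal complex is an induced subgraph of the form $a\to v_1-\cdots-v_r\gets b$ with $r\ge1$ (so the only edges among $a,v_1,\dots,v_r,b$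 are those displayed). The set of complex-spouses of $a$ is $csp(a)=\{b\in V : \text{there is a minimal complex } a\to v_1-\cdots-v_r\gets b\}$. The moral graph $G^m$ of a CG $G$ is the undirected graph on the same vertices in which $\alpha,\beta$ are adjacent iff $\alpha\to\beta$, $\beta\to\alpha$, $\alpha-\beta$, or $\alpha\in csp(\beta)$ in $G$. $G_A$ denotes the subgraph induced on $A$. Global Markov property: for all disjoint $A,B,S\subseteq V$ such that $S$ separates $A$ from $B$ in the undirected graph $(G_{An(A\cup B\cup S)})^m$, $A$ and $B$ are conditionally independent given $S$ under $P$. *)

theory Defs
  imports "HOL-Probability.Probability"
begin

text \<open>
  Graphs with directed edges (arrows) and undirected edges (lines). An undirected edge between
  \<open>u\<close> and \<open>v\<close> is the two-element set \<open>{u, v}\<close>. An undirected graph is a graph without arrows.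
\<close>

record 'v mixed_graph =
  verts :: "'v set"
  arrows :: "('v \<times> 'v) set"
  lines :: "'v set set"

definition simple_graph :: "'v mixed_graph \<Rightarrow> bool" where
  "simple_graph G \<longleftrightarrow>
     finite (verts G) \<and>
     arrows G \<subseteq> verts G \<times> verts G \<and>
     (\<forall>e\<in>lines G. e \<subseteq> verts G \<and> card e = 2) \<and>
     (\<forall>u v. (u, v) \<in> arrows G \<longrightarrow> u \<noteq> v \<and> (v, u) \<notin> arrows G \<and> {u, v} \<notin> lines G)"

definition partially_directed_cycle :: "'v mixed_graph \<Rightarrow> 'v list \<Rightarrow> bool" where
  "partially_directed_cycle G vs \<longleftrightarrow>
     length vs \<ge> 3 \<and> set vs \<subseteq> verts G \<and> last vs = hd vs \<and> distinct (butlast vs) \<and>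
     (\<forall>i. Suc i < length vs \<longrightarrow> {vs ! i, vs ! Suc i} \<in> lines G \<or> (vs ! i, vs ! Suc i) \<in> arrows G) \<and>
     (\<exists>j. Suc j < length vs \<and> (vs ! j, vs ! Suc j) \<in> arrows G)"

definition lwf_chain_graph :: "'v mixed_graph \<Rightarrow> bool" where
  "lwf_chain_graph G \<longleftrightarrow> simple_graph G \<and> (\<nexists>vs. partially_directed_cycle G vs)"

definition pa :: "'v mixed_graph \<Rightarrow> 'v \<Rightarrow> 'v set" where
  "pa G v = {u. (u, v) \<in> arrows G}"

definition ch :: "'v mixed_graph \<Rightarrow> 'v \<Rightarrow> 'v set" where
  "ch G v = {u. (v, u) \<in> arrows G}"

definition ne :: "'v mixed_graph \<Rightarrow> 'v \<Rightarrow> 'v set" where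
  "ne G v = {u. {u, v} \<in> lines G}"

definition bd :: "'v mixed_graph \<Rightarrow> 'v set \<Rightarrow> 'v set" where
  "bd G A = {u \<in> verts G - A. \<exists>a\<in>A. u \<in> pa G a \<union> ne G a}"

definition ancestral :: "'v mixed_graph \<Rightarrow> 'v set \<Rightarrow> bool" where
  "ancestral G A \<longleftrightarrow> A \<subseteq> verts G \<and> (\<forall>a\<in>A. bd G {a} \<subseteq> A)"

definition An :: "'v mixed_graph \<Rightarrow> 'v set \<Rightarrow> 'v set" where
  "An G A = \<Inter>{B. ancestral G B \<and> A \<subseteq> B}"

definition induced :: "'v mixed_graph \<Rightarrow> 'v set \<Rightarrow> 'v mixed_graph" where
  "induced G A =
     \<lparr>verts = A, arrows = arrows G \<inter> (A \<times> A), lines = {e \<in> lines G. e \<subseteq> A}\<rparr>"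

text \<open>
  In a minimal complex \<open>a \<rightarrow> v\<^sub>1 - \<dots> - v\<^sub>r \<leftarrow> b\<close> the vertices \<open>a, v\<^sub>1, \<dots>, v\<^sub>r, b\<close> are pairwise
  distinct; in particular no vertex is its own complex-spouse.
\<close>

definition minimal_complex :: "'v mixed_graph \<Rightarrow> 'v \<Rightarrow> 'v list \<Rightarrow> 'v \<Rightarrow> bool" where
  "minimal_complex G a vs b \<longleftrightarrow>
     vs \<noteq> [] \<and> distinct (a # vs @ [b]) \<and> set (a # vs @ [b]) \<subseteq> verts G \<and>
     induced G (set (a # vs @ [b])) =
       \<lparr>verts = set (a # vs @ [b]),
        arrows = {(a, hd vs), (b, last vs)},
        lines = {{vs ! i, vs ! Suc i} |i. Suc i < length vs}\<rparr>"

definition csp :: "'v mixed_graph \<Rightarrow> 'v \<Rightarrow> 'v set" where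
  "csp G a = {b \<in> verts G. \<exists>vs. minimal_complex G a vs b}"

definition Mb :: "'v mixed_graph \<Rightarrow> 'v \<Rightarrow> 'v set" where
  "Mb G t = bd G {t} \<union> ch G t \<union> csp G t"

definition moral_graph :: "'v mixed_graph \<Rightarrow> 'v mixed_graph" where
  "moral_graph G =
     \<lparr>verts = verts G, arrows = {},
      lines = {{\<alpha>, \<beta>} |\<alpha> \<beta>. \<alpha> \<in> verts G \<and> \<beta> \<in> verts G \<and>
        ((\<alpha>, \<beta>) \<in> arrows G \<or> (\<beta>, \<alpha>) \<in> arrows G \<or> {\<alpha>, \<beta>} \<in> lines G \<or> \<alpha> \<in> csp G \<beta>)}\<rparr>"

definition undirected_path :: "'v mixed_graph \<Rightarrow> 'v list \<Rightarrow> bool" where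
  "undirected_path H p \<longleftrightarrow>
     p \<noteq> [] \<and> distinct p \<and> set p \<subseteq> verts H \<and> successively (\<lambda>u v. {u, v} \<in> lines H) p"

definition separates :: "'v mixed_graph \<Rightarrow> 'v set \<Rightarrow> 'v set \<Rightarrow> 'v set \<Rightarrow> bool" where
  "separates H S A B \<longleftrightarrow>
     (\<forall>p. undirected_path H p \<and> hd p \<in> A \<and> last p \<in> B \<longrightarrow> set p \<inter> S \<noteq> {})"

text \<open>
  The random variable at a vertex \<open>v\<close> takes its values in an arbitrary measurable space \<open>N v\<close>. A joint
  distribution of the family is a probability measure on the product space, and the random
  variables themselves are the coordinate projections.
\<close>

definition joint_distribution :: "'v set \<Rightarrow> ('v \<Rightarrow> 'a measure) \<Rightarrow> ('v \<Rightarrow> 'a) measure \<Rightarrow> bool" where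
  "joint_distribution V N P \<longleftrightarrow> prob_space P \<and> sets P = sets (PiM V N)"

text \<open>The sigma-algebra on \<open>space P\<close> generated by the random variables in \<open>A\<close>.\<close>

definition generated_algebra ::
    "('v \<Rightarrow> 'a measure) \<Rightarrow> ('v \<Rightarrow> 'a) measure \<Rightarrow> 'v set \<Rightarrow> ('v \<Rightarrow> 'a) measure" where
  "generated_algebra N P A = vimage_algebra (space P) (\<lambda>x. restrict x A) (PiM A N)"

lemma subalgebra_generated_algebra:
  assumes "joint_distribution V N P" "A \<subseteq> V"
  shows "subalgebra P (generated_algebra N P A)"
proof -
  have "(\<lambda>x. restrict x A) \<in> measurable (PiM V N) (PiM A N)"
    using assms(2) by (rule measurable_restrict_subset)
  then have "(\<lambda>x. restrict x A) \<in> measurable P (PiM A N)"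
    using assms(1) by (simp add: joint_distribution_def cong: measurable_cong_sets)
  then have "sets (vimage_algebra (space P) (\<lambda>x. restrict x A) (PiM A N)) \<subseteq> sets P"
    by (intro sets_image_in_sets) simp_all
  then show ?thesis
    by (simp add: subalgebra_def generated_algebra_def)
qed

text \<open>
  The random variables in \<open>A\<close> are conditionally independent of those in \<open>B\<close> given those in \<open>S\<close>:
  \<open>P(E \<inter> F | S) = P(E | S) P(F | S)\<close> almost surely, for all events \<open>E\<close> and \<open>F\<close> determined by
  \<open>A\<close> and \<open>B\<close>, respectively.
\<close>

definition cond_indep ::
    "('v \<Rightarrow> 'a measure) \<Rightarrow> ('v \<Rightarrow> 'a) measure \<Rightarrow> 'v set \<Rightarrow> 'v set \<Rightarrow> 'v set \<Rightarrow> bool" where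
  "cond_indep N P A B S \<longleftrightarrow>
     (\<forall>E\<in>sets (generated_algebra N P A). \<forall>F\<in>sets (generated_algebra N P B).
        AE x in P.
          real_cond_exp P (generated_algebra N P S) (indicator (E \<inter> F)) x =
          real_cond_exp P (generated_algebra N P S) (indicator E) x *
          real_cond_exp P (generated_algebra N P S) (indicator F) x)"

definition global_markov ::
    "'v mixed_graph \<Rightarrow> ('v \<Rightarrow> 'a measure) \<Rightarrow> ('v \<Rightarrow> 'a) measure \<Rightarrow> bool" where
  "global_markov G N P \<longleftrightarrow>
     (\<forall>A B S. A \<subseteq> verts G \<and> B \<subseteq> verts G \<and> S \<subseteq> verts G \<and>
        A \<inter> B = {} \<and> A \<inter> S = {} \<and> B \<inter> S = {} \<and>
        separates (moral_graph (induced G (An G (A \<union> B \<union> S)))) S A B \<longrightarrow>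
        cond_indep N P A B S)"

definition lwf_chain_graph_model ::
    "'v mixed_graph \<Rightarrow> ('v \<Rightarrow> 'a measure) \<Rightarrow> ('v \<Rightarrow> 'a) measure \<Rightarrow> bool" where
  "lwf_chain_graph_model G N P \<longleftrightarrow>
     lwf_chain_graph G \<and> joint_distribution (verts G) N P \<and> global_markov G N P"

end

theory Submission
  imports Defs
begin

text \<open>
  Take \<open>A = {T}\<close>, \<open>S = Mb G T\<close> and let \<open>B\<close> be the remaining vertices. Then \<open>A \<union> B \<union> S\<close> is the whole
  vertex set, so the moral graph in the global Markov property is that of \<open>G\<close> itself. Since being a
  complex-spouse is symmetric, the neighbours of \<open>T\<close> in this moral graph are all in \<open>Mb G T\<close>, and a
  path from \<open>T\<close> to \<open>B\<close> meets \<open>Mb G T\<close> in its second vertex.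
\<close>

text \<open>Reversal turns each consecutive pair around, and unordered pairs forget the order. This
  serves the \<open>lines\<close> field of a reversed minimal complex.\<close>

lemma consecutive_pairs_rev_subset:
  "{{rev vs ! i, rev vs ! Suc i} |i. Suc i < length vs}
     \<subseteq> {{vs ! i, vs ! Suc i} |i. Suc i < length vs}"
proof
  fix e
  assume "e \<in> {{rev vs ! i, rev vs ! Suc i} |i. Suc i < length vs}"
  then obtain i where i: "Suc i < length vs" and e: "e = {rev vs ! i, rev vs ! Suc i}"
    by blast
  \<comment> \<open>\<open>rev vs ! i\<close> is \<open>vs ! Suc j\<close> and
    \<open>rev vs ! Suc i\<close> is \<open>vs ! j\<close>.\<close>
  define j where "j = length vs - Suc (Suc i)"
  have j: "Suc j < length vs" "length vs - Suc i = Suc j"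
    using i by (auto simp: j_def)
  have "e = {vs ! j, vs ! Suc j}"
    using i j by (auto simp: e rev_nth simp flip: j_def)
  then show "e \<in> {{vs ! i, vs ! Suc i} |i. Suc i < length vs}"
    using j by blast
qed

lemma consecutive_pairs_rev:
  "{{rev vs ! i, rev vs ! Suc i} |i. Suc i < length vs}
     = {{vs ! i, vs ! Suc i} |i. Suc i < length vs}"
  using consecutive_pairs_rev_subset[of vs] consecutive_pairs_rev_subset[of "rev vs"]
  unfolding rev_rev_ident length_rev by (rule subset_antisym)

text \<open>Reading a complex from its other end keeps the same induced subgraph: vertex set, pair
  of arrows and set of lines are all symmetric under reversal.\<close>

lemma minimal_complex_rev:
  assumes "minimal_complex G a vs b"
  shows "minimal_complex G b (rev vs) a"
proof -
  have verts: "set (b # rev vs @ [a]) = set (a # vs @ [b])"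
    by auto
  have arrows: "{(b, hd (rev vs)), (a, last (rev vs))} = {(a, hd vs), (b, last vs)}"
    by (simp add: hd_rev last_rev insert_commute)
  have "rev vs \<noteq> []" "distinct (b # rev vs @ [a])"
    using assms by (auto simp: minimal_complex_def)
  then show ?thesis
    using assms unfolding minimal_complex_def verts arrows length_rev consecutive_pairs_rev
    by blast
qed

lemma csp_sym:
  assumes "a \<in> csp G b" "b \<in> verts G"
  shows "b \<in> csp G a"
  using assms by (auto simp: csp_def intro: minimal_complex_rev)

text \<open>\<open>bd\<close> leaves out \<open>T\<close> by definition, \<open>ch\<close> because
  there are no loops, and \<open>csp\<close> because the vertices of a minimal complex are
  distinct.\<close>

lemma not_in_Mb_self:
  assumes "simple_graph G"
  shows "T \<notin> Mb G T"
  using assms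
  by (auto simp: Mb_def bd_def ch_def csp_def minimal_complex_def simple_graph_def)

lemma Mb_subset_verts:
  assumes "simple_graph G"
  shows "Mb G T \<subseteq> verts G"
  using assms by (auto simp: Mb_def bd_def ch_def csp_def simple_graph_def)

lemma An_verts: "An G (verts G) = verts G"
proof -
  have "ancestral G (verts G)"
    by (auto simp: ancestral_def bd_def)
  then show ?thesis
    unfolding An_def by blast
qed

lemma induced_verts:
  assumes "simple_graph G"
  shows "induced G (verts G) = G"
proof -
  have "arrows G \<inter> verts G \<times> verts G = arrows G" "{e \<in> lines G. e \<subseteq> verts G} = lines G"
    using assms by (auto simp: simple_graph_def)
  then show ?thesis
    by (simp add: induced_def)
qed

lemma moral_graph_neighbour_in_Mb:
  assumes G: "simple_graph G" and line: "{T, w} \<in> lines (moral_graph G)"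
    and neq: "w \<noteq> T"
  shows "w \<in> Mb G T"
proof -
  obtain \<alpha> \<beta> where eq: "{T, w} = {\<alpha>, \<beta>}" and V: "\<alpha> \<in> verts G" "\<beta> \<in> verts G"
    and adj: "(\<alpha>, \<beta>) \<in> arrows G \<or> (\<beta>, \<alpha>) \<in> arrows G \<or> {\<alpha>, \<beta>} \<in> lines G \<or> \<alpha> \<in> csp G \<beta>"
    using line unfolding moral_graph_def mixed_graph.select_convs by blast
  \<comment> \<open>\<open>T\<close> may be either end of the unordered pair, so the complex-spouse
    relation is needed in both directions.\<close>
  have "\<beta> \<in> csp G \<alpha>" if "\<alpha> \<in> csp G \<beta>"
    using that V(2) by (rule csp_sym)
  moreover have "\<alpha> = T \<and> \<beta> = w \<or> \<alpha> = w \<and> \<beta> = T"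
    using eq unfolding doubleton_eq_iff by blast
  ultimately show ?thesis
    using V adj neq insert_commute[of T w "{}"]
    unfolding Mb_def bd_def ch_def pa_def ne_def by auto
qed

lemma Mb_separates:
  assumes "simple_graph G"
  shows "separates (moral_graph G) (Mb G T) {T} (verts G - ({T} \<union> Mb G T))"
  unfolding separates_def
proof (intro allI impI, elim conjE)
  fix p
  assume p: "undirected_path (moral_graph G) p" "hd p \<in> {T}"
    "last p \<in> verts G - ({T} \<union> Mb G T)"
  \<comment> \<open>The path has a second vertex, since its last vertex differs from
    \<open>T\<close>.\<close>
  then obtain w q where pq: "p = T # w # q"
    by (cases p; cases "tl p") (auto simp: undirected_path_def)
  have "{T, w} \<in> lines (moral_graph G)" "w \<noteq> T"
    using p(1) by (auto simp: undirected_path_def pq)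
  then have "w \<in> Mb G T"
    using moral_graph_neighbour_in_Mb[OF assms] by blast
  then show "set p \<inter> Mb G T \<noteq> {}"
    by (auto simp: pq)
qed

theorem theorem1:
  fixes G :: "'v mixed_graph"
    and N :: "'v \<Rightarrow> 'a measure"
    and P :: "('v \<Rightarrow> 'a) measure"
    and T :: 'v
  assumes "lwf_chain_graph_model G N P"
    and "T \<in> verts G"
  shows "cond_indep N P {T} (verts G - ({T} \<union> Mb G T)) (Mb G T)"
proof -
  let ?B = "verts G - ({T} \<union> Mb G T)"
  have G: "simple_graph G" and markov: "global_markov G N P"
    using assms(1) by (auto simp: lwf_chain_graph_model_def lwf_chain_graph_def)
  have "{T} \<union> ?B \<union> Mb G T = verts G"
    using assms(2) Mb_subset_verts[OF G] by blast
  then have "separates (moral_graph (induced G (An G ({T} \<union> ?B \<union> Mb G T)))) (Mb G T) {T} ?B"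
    by (simp only: An_verts induced_verts[OF G] Mb_separates[OF G])
  \<comment> \<open>Besides separation, the Markov property asks for disjoint sets of
    vertices.\<close>
  moreover have "T \<notin> Mb G T" "Mb G T \<subseteq> verts G"
    using not_in_Mb_self[OF G] Mb_subset_verts[OF G] by auto
  ultimately show ?thesis
    using assms(2) by (intro markov[unfolded global_markov_def, rule_format]) auto
qed

end
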